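(* Let $w\in S_n$, let $C^N(w)$ be the nested climbing chain of $w$, and let $\xi(w)=(C^N(w),M(C^N(w)))$. Then $$\overline{\mathrm{wt}}(\xi(w))=\overline{\mathrm{rajcode}}(w).$$
   Context: Conventions. Permutations are in one-line notation; $t_{ij}$ is the transposition of $i,j$, and $wt_{ij}$ is $w$ with the values in positions $i$ and $j$ exchanged. $w_0\in S_n$ is the longest permutation, $w_0(k)=n+1-k$. The Bruhat order is the transitive closure of $w\le wt_{ij}$ for $i<j$ with $w(i)<w(j)$; $\lessdot$ denotes its cover relation. $[n]=\{1,\ldots,n\}$. Climbing chains. A climbing chain of $w\in S_n$ is a sequence $C=(C_1,\ldots,C_m)$ of pairs (links) $C_p=(i_p,j_p)$ with $i_p<j_p$, $i_1\le\cdots\le i_m$, $wt_{i_1j_1}\cdots t_{i_mj_m}=w_0$, and $wt_{i_1j_1}\cdots t_{i_{p-1}j_{p-1}}\lessdot wt_{i_1j_1}\cdots t_{i_pj_p}$ for each $p\in[m]$. (The only climbing chain of $w_0$ is empty. The links of a chain are distinct, so $C$ is also regarded as a set.) The set of minimal markings is $M(C)=\{C_p\mid i_{p-1}<i_p,\text{ or } i_{p-1}=i_p\text{ and }j_{p-1}<j_p\}$ with $i_0=0$. For $M(C)\subseteq U\subseteq C$, the dual weight $\overline{\mathrm{wt}}(C,U)\in\mathbb{Z}^n$ has $k$th entry the number of links of the form $(k,\star)$ in $U$. Increasing subsequences. An increasing subsequence of $w$ starting from position $q$ is $\alpha=(\alpha_1,\ldots,\alpha_r)$ with $q=\alpha_1<\cdots<\alpha_r\le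 n$ and $w(\alpha_1)<\cdots<w(\alpha_r)$; $\mathrm{LIS}(w,q)$ is the set of those of maximal length $r$. $\overline{\mathrm{rajcode}}(w)\in\mathbb{Z}^n$ has $i$th entry the length of any element of $\mathrm{LIS}(w,i)$ minus one. Nested chain. For $w\ne w_0$, let $q=\min\{j\mid w(j)\ne n+1-j\}$, let $\alpha$ be the lexicographically last element of $\mathrm{LIS}(w,q)$, and set $\mathrm{nested}(w)=(\alpha_1,\alpha_2)$. $C^N(w_0)$ is empty; for $w\neq w_0$ with $\mathrm{nested}(w)=(a,b)$, $C^N(w)$ is obtained by prepending $(a,b)$ to $C^N(wt_{ab})$. It is a climbing chain of $w$. *)

theory Defs
  imports "HOL-Combinatorics.Permutations" "HOL-Library.List_Lexorder"
begin

(* Elements of S_n are functions w with "w permutes {1..n}"; they fix every number outside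
   {1..n}.  The product w t_ij is "w \<circ> transpose i j". *)

definition longest_perm :: "nat \<Rightarrow> nat \<Rightarrow> nat" where
  "longest_perm n k = (if k \<in> {1..n} then n + 1 - k else k)"

definition incr_subseqs :: "nat \<Rightarrow> (nat \<Rightarrow> nat) \<Rightarrow> nat \<Rightarrow> nat list set" where
  "incr_subseqs n w q =
     {\<alpha>. \<alpha> \<noteq> [] \<and> hd \<alpha> = q \<and> set \<alpha> \<subseteq> {1..n} \<and> sorted_wrt (<) \<alpha> \<and> sorted_wrt (<) (map w \<alpha>)}"

definition LIS :: "nat \<Rightarrow> (nat \<Rightarrow> nat) \<Rightarrow> nat \<Rightarrow> nat list set" where
  "LIS n w q =
     {\<alpha> \<in> incr_subseqs n w q. \<forall>\<beta> \<in> incr_subseqs n w q. length \<beta> \<le> length \<alpha>}"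

(* Vectors in Z^n are integer lists of length n; the k-th entry (counted from 1) is at list
   index k - 1. *)

definition dual_rajcode :: "nat \<Rightarrow> (nat \<Rightarrow> nat) \<Rightarrow> int list" where
  "dual_rajcode n w = map (\<lambda>i. int (length (SOME \<alpha>. \<alpha> \<in> LIS n w i)) - 1) [1..<n + 1]"

(* Chains are lists of links, so C_p is "C ! (p - 1)".  In "0 # map fst C" the entry at index p
   is i_p, with i_0 = 0. *)

definition minimal_markings :: "(nat \<times> nat) list \<Rightarrow> (nat \<times> nat) set" where
  "minimal_markings C =
     {C ! (p - 1) | p. p \<in> {1..length C} \<and>
        (let i = (\<lambda>r. (0 # map fst C) ! r); j = (\<lambda>r. snd (C ! (r - 1)))
         in i (p - 1) < i p \<or> (p \<ge> 2 \<and> i (p - 1) = i p \<and> j (p - 1) < j p))}"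

definition dual_wt :: "nat \<Rightarrow> (nat \<times> nat) list \<times> (nat \<times> nat) set \<Rightarrow> int list" where
  "dual_wt n = (\<lambda>(C, U). map (\<lambda>k. int (card {l \<in> U. fst l = k})) [1..<n + 1])"

(* Max is taken in the dictionary order on lists from List_Lexorder. *)

definition nested :: "nat \<Rightarrow> (nat \<Rightarrow> nat) \<Rightarrow> nat \<times> nat" where
  "nested n w =
     (let q = (LEAST j. j \<in> {1..n} \<and> w j \<noteq> n + 1 - j); \<alpha> = Max (LIS n w q)
      in (\<alpha> ! 0, \<alpha> ! 1))"

lemma finite_incr_subseqs: "finite (incr_subseqs n w q)"
proof (rule finite_subset)
  show "incr_subseqs n w q \<subseteq> {\<alpha>. set \<alpha> \<subseteq> {1..n} \<and> distinct \<alpha>}"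
    by (auto simp: incr_subseqs_def strict_sorted_iff)
qed (auto intro: finite_subset_distinct)

lemma finite_LIS: "finite (LIS n w q)"
  by (rule finite_subset[OF _ finite_incr_subseqs[of n w q]]) (auto simp: LIS_def)

lemma LIS_nonempty:
  assumes "q \<in> {1..n}"
  shows "LIS n w q \<noteq> {}"
proof -
  let ?S = "incr_subseqs n w q"
  have "[q] \<in> ?S" using assms by (simp add: incr_subseqs_def)
  then have "Max (length ` ?S) \<in> length ` ?S"
    using finite_incr_subseqs[of n w q] by (intro Max_in) auto
  then obtain \<alpha> where \<alpha>: "\<alpha> \<in> ?S" "length \<alpha> = Max (length ` ?S)" by auto
  have "length \<beta> \<le> length \<alpha>" if "\<beta> \<in> ?S" for \<beta>
    using that \<alpha>(2) finite_incr_subseqs[of n w q] by simp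
  with \<alpha>(1) show ?thesis by (auto simp: LIS_def)
qed

lemma nested_increasing:
  assumes w: "w permutes {1..n}" and ne: "w \<noteq> longest_perm n" and ab: "nested n w = (a, b)"
  shows "1 \<le> a" "a < b" "b \<le> n" "w a < w b"
proof -
  let ?P = "\<lambda>j. j \<in> {1..n} \<and> w j \<noteq> n + 1 - j"
  define q where "q = Least ?P"
  have "\<exists>j. ?P j"
  proof (rule ccontr)
    assume "\<nexists>j. ?P j"
    then have "w j = longest_perm n j" for j
      using permutes_not_in[OF w] by (auto simp: longest_perm_def)
    with ne show False by auto
  qed
  then have q: "?P q" unfolding q_def by (rule LeastI_ex)
  have below: "w j = n + 1 - j" if "j \<in> {1..n}" "j < q" for j
    using not_less_Least[of j ?P] that unfolding q_def by blast
  obtain c where c: "w c = n + 1 - q" using permutes_surj[OF w] by (metis surjD)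
  have c_in: "c \<in> {1..n}" using permutes_in_image[OF w, of c] c q by auto
  have "c \<noteq> q" using c q by auto
  moreover have "\<not> c < q" using below[of c] c c_in q by auto
  ultimately have qc: "q < c" by simp
  have wq_in: "w q \<in> {1..n}" using permutes_in_image[OF w, of q] q by auto
  have "w q < n + 1 - q"
  proof (rule ccontr)
    assume "\<not> w q < n + 1 - q"
    then have j: "n + 1 - w q \<in> {1..n}" "n + 1 - w q < q" using q wq_in by auto
    then have "w (n + 1 - w q) = w q" using below[OF j] wq_in by auto
    then have "n + 1 - w q = q" using permutes_inj[OF w] by (metis injD)
    with j show False by simp
  qed
  then have "[q, c] \<in> incr_subseqs n w q" using qc c c_in q by (auto simp: incr_subseqs_def)
  moreover define \<alpha> where "\<alpha> = Max (LIS n w q)"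
  have \<alpha>_in: "\<alpha> \<in> LIS n w q"
    unfolding \<alpha>_def by (rule Max_in[OF finite_LIS LIS_nonempty]) (use q in auto)
  ultimately have len: "2 \<le> length \<alpha>" by (auto simp: LIS_def)
  then obtain x y zs where xy: "\<alpha> = x # y # zs"
    by (metis One_nat_def Suc_1 Suc_le_length_iff)
  have "(a, b) = (x, y)" using ab xy by (simp add: nested_def Let_def q_def \<alpha>_def)
  then show "1 \<le> a" "a < b" "b \<le> n" "w a < w b"
    using \<alpha>_in xy by (auto simp: LIS_def incr_subseqs_def)
qed

function nested_chain :: "nat \<Rightarrow> (nat \<Rightarrow> nat) \<Rightarrow> (nat \<times> nat) list" where
  "nested_chain n w =
     (if w permutes {1..n} \<and> w \<noteq> longest_perm n
      then (case nested n w of (a, b) \<Rightarrow> (a, b) # nested_chain n (w \<circ> transpose a b))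
      else [])"
  by pat_completeness auto

termination
proof (relation "measure (\<lambda>(n, w). \<Sum>i\<in>{1..n}. i * w i)", goal_cases)
  case 1
  show ?case by simp
next
  case (2 n w a b)
  then have ab: "1 \<le> a" "a < b" "b \<le> n" "w a < w b"
    using nested_increasing[of w n a b] by auto
  let ?S = "{1..n} - {a} - {b}"
  have split: "(\<Sum>i\<in>{1..n}. i * v i) = a * v a + (b * v b + (\<Sum>i\<in>?S. i * v i))" for v :: "nat \<Rightarrow> nat"
    using ab by (simp add: sum.remove[of _ a] sum.remove[of _ b])
  have rest: "(\<Sum>i\<in>?S. i * (w \<circ> transpose a b) i) = (\<Sum>i\<in>?S. i * w i)"
    by (rule sum.cong) (auto simp: transpose_def)
  obtain d e where d: "b = a + d" "d > 0" and e: "w b = w a + e" "e > 0"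
    using ab by (metis less_imp_add_positive)
  have "a * w b + b * w a < a * w a + b * w b"
    unfolding e(1) unfolding d(1) using d(2) e(2) by (simp add: algebra_simps)
  then show ?case
    using rest by (simp only: in_measure prod.case split) simp
qed

declare nested_chain.simps [simp del]

definition xi :: "nat \<Rightarrow> (nat \<Rightarrow> nat) \<Rightarrow> (nat \<times> nat) list \<times> (nat \<times> nat) set" where
  "xi n w = (nested_chain n w, minimal_markings (nested_chain n w))"

end

theory Submission
  imports Defs
begin

text \<open>Let \<open>\<ell>(w,k)\<close> be the length of the elements of \<open>LIS(w,k)\<close>. If \<open>nested(w) = (a,b)\<close>, then \<open>b\<close> is the
  largest position after \<open>a\<close> with \<open>w(b) > w(a)\<close> and \<open>\<ell>(w,b) = \<ell>(w,a) - 1\<close>. For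
  \<open>w' = w t\<^bsub>ab\<^esub>\<close> this gives \<open>\<ell>(w',k) = \<ell>(w,k)\<close> for all \<open>k \<noteq> a\<close>, while \<open>\<ell>(w',a)\<close> is \<open>\<ell>(w,a)\<close> or
  \<open>\<ell>(w,a) - 1\<close>. If the length at \<open>a\<close> is unchanged, then the next link is \<open>(a,d)\<close> with \<open>d < b\<close> and
  is unmarked; if it drops, then the next link is \<open>(a,d)\<close> with \<open>d > b\<close>, or starts after \<open>a\<close>, and is
  marked. Hence the marked links at \<open>a\<close> count the \<open>\<ell>(w,a) - 1\<close> drops.\<close>

subsection \<open>Lengths of longest increasing subsequences\<close>

text \<open>The maximum is over a nonempty set exactly when \<open>k\<close> lies in
  \<open>{1..n}\<close>; for other \<open>k\<close> the value is unspecified, whence the range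
  hypotheses below.\<close>

definition LIS_length :: "nat \<Rightarrow> (nat \<Rightarrow> nat) \<Rightarrow> nat \<Rightarrow> nat" where
  "LIS_length n w k = Max (length ` incr_subseqs n w k)"

text \<open>These are the positions that can directly follow \<open>k\<close> in an increasing
  subsequence.\<close>

definition larger_after :: "nat \<Rightarrow> (nat \<Rightarrow> nat) \<Rightarrow> nat \<Rightarrow> nat set" where
  "larger_after n w k = {j \<in> {1..n}. k < j \<and> w k < w j}"

lemma finite_larger_after [simp]: "finite (larger_after n w k)"
  by (simp add: larger_after_def)

lemma singleton_in_incr_subseqs: "k \<in> {1..n} \<Longrightarrow> [k] \<in> incr_subseqs n w k"
  by (simp add: incr_subseqs_def)

lemma Cons_in_incr_subseqs:
  assumes "k \<in> {1..n}" "j \<in> larger_after n w k" "\<beta> \<in> incr_subseqs n w j"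
  shows "k # \<beta> \<in> incr_subseqs n w k"
  using assms by (cases \<beta>) (auto simp: incr_subseqs_def larger_after_def)

lemma incr_subseqs_cases:
  assumes "\<alpha> \<in> incr_subseqs n w k"
  obtains "\<alpha> = [k]"
  | j \<beta> where "\<alpha> = k # j # \<beta>" "j \<in> larger_after n w k" "j # \<beta> \<in> incr_subseqs n w j"
proof (cases \<alpha>)
  case Nil
  with assms show thesis by (simp add: incr_subseqs_def)
next
  case (Cons x \<gamma>)
  with assms that show thesis
    by (cases \<gamma>) (auto simp: incr_subseqs_def larger_after_def)
qed

lemma length_le_LIS_length: "\<alpha> \<in> incr_subseqs n w k \<Longrightarrow> length \<alpha> \<le> LIS_length n w k"
  unfolding LIS_length_def using finite_incr_subseqs by (intro Max_ge) auto

lemma LIS_length_attained: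
  assumes "k \<in> {1..n}"
  obtains \<alpha> where "\<alpha> \<in> incr_subseqs n w k" "length \<alpha> = LIS_length n w k"
proof -
  have "LIS_length n w k \<in> length ` incr_subseqs n w k"
    unfolding LIS_length_def using finite_incr_subseqs[of n w k] singleton_in_incr_subseqs[OF assms, of w]
    by (intro Max_in) auto
  with that show thesis by auto
qed

lemma LIS_iff:
  assumes "k \<in> {1..n}"
  shows "\<alpha> \<in> LIS n w k \<longleftrightarrow> \<alpha> \<in> incr_subseqs n w k \<and> length \<alpha> = LIS_length n w k"
proof
  assume \<alpha>: "\<alpha> \<in> LIS n w k"
  obtain \<beta> where "\<beta> \<in> incr_subseqs n w k" "length \<beta> = LIS_length n w k"
    using assms by (rule LIS_length_attained)
  with \<alpha> have "LIS_length n w k \<le> length \<alpha>" by (auto simp: LIS_def)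
  with \<alpha> length_le_LIS_length[of \<alpha> n w k]
  show "\<alpha> \<in> incr_subseqs n w k \<and> length \<alpha> = LIS_length n w k" by (simp add: LIS_def)
qed (auto simp: LIS_def length_le_LIS_length)

lemma LIS_length_pos: "k \<in> {1..n} \<Longrightarrow> 1 \<le> LIS_length n w k"
  using length_le_LIS_length[OF singleton_in_incr_subseqs] by simp

lemma LIS_length_ge_Suc:
  assumes "k \<in> {1..n}" "j \<in> larger_after n w k"
  shows "Suc (LIS_length n w j) \<le> LIS_length n w k"
proof -
  have "j \<in> {1..n}" using assms by (simp add: larger_after_def)
  then obtain \<beta> where "\<beta> \<in> incr_subseqs n w j" "length \<beta> = LIS_length n w j"
    by (rule LIS_length_attained)
  with length_le_LIS_length[OF Cons_in_incr_subseqs[OF assms]] show ?thesis by fastforce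
qed

lemma LIS_length_eq_Suc:
  assumes "k \<in> {1..n}" "2 \<le> LIS_length n w k"
  obtains j where "j \<in> larger_after n w k" "LIS_length n w k = Suc (LIS_length n w j)"
proof -
  obtain \<alpha> where \<alpha>: "\<alpha> \<in> incr_subseqs n w k" "length \<alpha> = LIS_length n w k"
    using assms(1) by (rule LIS_length_attained)
  from \<alpha>(1) show thesis
  proof (cases rule: incr_subseqs_cases)
    case 1
    with \<alpha> assms show thesis by simp
  next
    case (2 j \<beta>)
    have "LIS_length n w k \<le> Suc (LIS_length n w j)"
      using length_le_LIS_length[OF 2(3)] 2(1) \<alpha>(2) by simp
    with LIS_length_ge_Suc[OF assms(1) 2(2)] 2(2) that show thesis by force
  qed
qed

text \<open>Dropping the first entry leaves a longest subsequence from some follower of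
  \<open>k\<close>. The inserted \<open>0\<close> covers the case without followers, where the
  length is 1.\<close>

lemma LIS_length_rec:
  assumes "k \<in> {1..n}"
  shows "LIS_length n w k = Suc (Max (insert 0 (LIS_length n w ` larger_after n w k)))"
proof (cases "2 \<le> LIS_length n w k")
  case True
  with assms obtain j where j: "j \<in> larger_after n w k" "LIS_length n w k = Suc (LIS_length n w j)"
    by (rule LIS_length_eq_Suc)
  have "Max (insert 0 (LIS_length n w ` larger_after n w k)) = LIS_length n w j"
    using LIS_length_ge_Suc[OF assms, of _ w] j by (intro Max_eqI) auto
  with j show ?thesis by simp
next
  case False
  then have "larger_after n w k = {}"
    using LIS_length_ge_Suc[OF assms, of _ w] LIS_length_pos[of _ n w]
    by (fastforce simp: larger_after_def)
  with False LIS_length_pos[OF assms, of w] show ?thesis by simp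
qed

text \<open>Two permutations are compared through this lemma by induction from the right end: it
  suffices that \<open>k\<close> has the same followers and that these have the same
  lengths.\<close>

lemma LIS_length_cong:
  assumes "k \<in> {1..n}" "larger_after n v k = larger_after n w k"
    "\<And>j. j \<in> larger_after n w k \<Longrightarrow> LIS_length n v j = LIS_length n w j"
  shows "LIS_length n v k = LIS_length n w k"
proof -
  have "LIS_length n v ` larger_after n v k = LIS_length n w ` larger_after n w k"
    unfolding assms(2) using assms(3) by (rule image_cong[OF refl])
  then show ?thesis unfolding LIS_length_rec[OF assms(1)] by simp
qed

lemma dual_rajcode_eq: "dual_rajcode n w = map (\<lambda>k. int (LIS_length n w k) - 1) [1..<n + 1]"
proof -
  have "length (SOME \<alpha>. \<alpha> \<in> LIS n w k) = LIS_length n w k" if "k \<in> {1..n}" for k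
  proof -
    have "(SOME \<alpha>. \<alpha> \<in> LIS n w k) \<in> LIS n w k"
      using LIS_nonempty[OF that] by (simp add: some_in_eq)
    with LIS_iff[OF that] show ?thesis by blast
  qed
  then show ?thesis unfolding dual_rajcode_def by (intro map_cong refl) auto
qed

subsection \<open>The first link of the nested chain\<close>

text \<open>All values above \<open>n + 1 - k\<close> are already used at positions before
  \<open>k\<close>, so by injectivity none of them occurs later.\<close>

lemma matched_prefix_no_larger_after:
  assumes w: "w permutes {1..n}" and k: "k \<in> {1..n}" and match: "\<forall>l\<in>{1..k}. w l = n + 1 - l"
  shows "larger_after n w k = {}"
proof (rule ccontr)
  assume "larger_after n w k \<noteq> {}"
  then obtain j where j: "j \<in> {1..n}" "k < j" "w k < w j" by (auto simp: larger_after_def)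
  have wj: "w j \<in> {1..n}" using permutes_in_image[OF w] j(1) by simp
  have "w k = n + 1 - k" using match k by simp
  then have "n + 1 - w j \<in> {1..k}" using j(3) wj by auto
  then have "w (n + 1 - w j) = n + 1 - (n + 1 - w j)" using match by blast
  then have "w (n + 1 - w j) = w j" using wj by simp
  then have "n + 1 - w j = j" using permutes_inj[OF w] by (metis injD)
  with j \<open>w k = n + 1 - k\<close> show False by simp
qed

lemma LIS_length_matched_prefix:
  assumes "w permutes {1..n}" "k \<in> {1..n}" "\<forall>l\<in>{1..k}. w l = n + 1 - l"
  shows "LIS_length n w k = 1"
  unfolding LIS_length_rec[OF assms(2)] matched_prefix_no_larger_after[OF assms] by simp

text \<open>These facts characterise the first link without reference to the dictionary order:
  \<open>a\<close> is the leftmost unmatched position, and \<open>b\<close> is the rightmost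
  follower of \<open>a\<close> that continues a longest subsequence.\<close>

lemma nested_props:
  assumes w: "w permutes {1..n}" and ne: "w \<noteq> longest_perm n" and ab: "nested n w = (a, b)"
  shows nested_unmatched: "w a \<noteq> n + 1 - a"
    and nested_matched_below: "\<And>l. l \<in> {1..<a} \<Longrightarrow> w l = n + 1 - l"
    and nested_LIS_length: "LIS_length n w a = Suc (LIS_length n w b)"
    and nested_maximal: "\<And>j. j \<in> larger_after n w a \<Longrightarrow> LIS_length n w a = Suc (LIS_length n w j) \<Longrightarrow> j \<le> b"
proof -
  note inc = nested_increasing[OF w ne ab]
  let ?P = "\<lambda>j. j \<in> {1..n} \<and> w j \<noteq> n + 1 - j"
  define q where "q = Least ?P"
  define \<alpha> where "\<alpha> = Max (LIS n w q)"
  have "\<exists>j. ?P j"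
  proof (rule ccontr)
    assume "\<nexists>j. ?P j"
    then have "w j = longest_perm n j" for j
      using permutes_not_in[OF w] by (auto simp: longest_perm_def)
    with ne show False by auto
  qed
  then have q: "?P q" unfolding q_def by (rule LeastI_ex)
  have below: "w j = n + 1 - j" if "j \<in> {1..n}" "j < q" for j
    using not_less_Least[of j ?P] that unfolding q_def by blast
  have "\<alpha> \<in> LIS n w q"
    unfolding \<alpha>_def by (rule Max_in[OF finite_LIS LIS_nonempty]) (use q in auto)
  then have \<alpha>: "\<alpha> \<in> incr_subseqs n w q" "length \<alpha> = LIS_length n w q"
    using LIS_iff q by auto
  have ab': "a = \<alpha> ! 0" "b = \<alpha> ! 1"
    using ab by (simp_all add: nested_def Let_def q_def \<alpha>_def)
  have aq: "a = q" using \<alpha>(1) ab'(1) by (auto simp: incr_subseqs_def hd_conv_nth)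
  show "w a \<noteq> n + 1 - a" "\<And>l. l \<in> {1..<a} \<Longrightarrow> w l = n + 1 - l"
    using q below by (auto simp: aq)
  have b: "b \<in> larger_after n w q" using inc by (auto simp: larger_after_def aq)
  with LIS_length_ge_Suc[of q n b w] LIS_length_pos[of b n w] q have two: "2 \<le> length \<alpha>"
    by (auto simp: \<alpha>(2) larger_after_def)
  from \<alpha>(1) obtain \<beta> where \<beta>: "\<alpha> = q # b # \<beta>" "b # \<beta> \<in> incr_subseqs n w b"
    using two ab'(2) by (cases rule: incr_subseqs_cases) auto
  then show "LIS_length n w a = Suc (LIS_length n w b)"
    using LIS_length_ge_Suc[of q n b w] b q length_le_LIS_length[OF \<beta>(2)] \<alpha>(2) aq by auto
  show "j \<le> b" if j: "j \<in> larger_after n w a" "LIS_length n w a = Suc (LIS_length n w j)" for j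
  proof -
    have "j \<in> {1..n}" using j by (simp add: larger_after_def)
    then obtain \<gamma> where \<gamma>: "\<gamma> \<in> incr_subseqs n w j" "length \<gamma> = LIS_length n w j"
      by (rule LIS_length_attained)
    \<comment> \<open>A longest subsequence through \<open>j\<close> competes with the lexicographic
      maximum; both start with \<open>q\<close>, so the second entries give
      \<open>j \<le> b\<close>.\<close>
    then have "q # \<gamma> \<in> LIS n w q"
      using LIS_iff[of q n] q j Cons_in_incr_subseqs[of q n j w \<gamma>] by (simp add: aq)
    then have "q # \<gamma> \<le> \<alpha>" unfolding \<alpha>_def using finite_LIS by (intro Max_ge)
    moreover obtain \<delta> where "\<gamma> = j # \<delta>"
      using \<gamma>(1) by (cases \<gamma>) (auto simp: incr_subseqs_def)
    ultimately show ?thesis by (auto simp: \<beta>(1) less_imp_le)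
  qed
qed

lemma nested_fst_ge:
  assumes "w permutes {1..n}" "w \<noteq> longest_perm n" "nested n w = (a, b)"
    "\<And>l. l \<in> {1..<k} \<Longrightarrow> w l = n + 1 - l"
  shows "k \<le> a"
proof (rule ccontr)
  assume "\<not> k \<le> a"
  then have "a \<in> {1..<k}" using nested_increasing(1)[OF assms(1-3)] by simp
  with assms(4) nested_unmatched[OF assms(1-3)] show False by blast
qed

subsection \<open>Applying one link\<close>

context
  fixes n w a b
  assumes w: "w permutes {1..n}" and ne: "w \<noteq> longest_perm n" and ab: "nested n w = (a, b)"
begin

private lemma a_b: "a \<in> {1..n}" "b \<in> {1..n}" "a < b" "w a < w b" "b \<in> larger_after n w a"
  using nested_increasing[OF w ne ab] by (auto simp: larger_after_def)

private definition "w' = w \<circ> transpose a b"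

private lemma w'_simps: "w' a = w b" "w' b = w a" "\<And>k. k \<noteq> a \<Longrightarrow> k \<noteq> b \<Longrightarrow> w' k = w k"
  by (simp_all add: w'_def)

private lemma w'_permutes: "w' permutes {1..n}"
  unfolding w'_def using a_b by (intro permutes_compose[OF permutes_swap_id w]) auto

private lemma w'_matched_below: "l \<in> {1..<a} \<Longrightarrow> w' l = n + 1 - l"
  using nested_matched_below[OF w ne ab, of l] w'_simps(3)[of l] a_b(3) by simp

text \<open>The swap changes no value to the right of \<open>b\<close>.\<close>

private lemma LIS_length_after_b:
  assumes "k \<in> {1..n}" "b < k"
  shows "LIS_length n w' k = LIS_length n w k"
  using assms
proof (induction "n - k" arbitrary: k rule: less_induct)
  case less
  have "larger_after n w' k = larger_after n w k"
    using less.prems a_b(3) w'_simps(3) unfolding larger_after_def by auto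
  with less.prems(1) show ?case
  proof (rule LIS_length_cong)
    fix j assume "j \<in> larger_after n w k"
    then have j: "j \<in> {1..n}" "k < j" by (auto simp: larger_after_def)
    with less.prems have "n - j < n - k" "b < j" by auto
    with j(1) show "LIS_length n w' j = LIS_length n w j" by (intro less.hyps)
  qed
qed

text \<open>The value at \<open>b\<close> falls from \<open>w b\<close> to \<open>w a\<close>, which
  can only add followers. Any follower \<open>j\<close> of \<open>b\<close> in \<open>w'\<close>
  also follows \<open>a\<close> in \<open>w\<close>, and \<open>j > b\<close>, so by maximality of
  \<open>b\<close> it does not continue a longest subsequence from \<open>a\<close>. Its length is
  therefore below that of \<open>b\<close>, and the maximum at \<open>b\<close> does not
  grow.\<close>

private lemma LIS_length_at_b: "LIS_length n w' b = LIS_length n w b"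
proof (rule antisym)
  show "LIS_length n w b \<le> LIS_length n w' b"
  proof (cases "2 \<le> LIS_length n w b")
    case True
    then obtain j where j: "j \<in> larger_after n w b" "LIS_length n w b = Suc (LIS_length n w j)"
      using LIS_length_eq_Suc a_b(2) by blast
    then have "j \<in> larger_after n w' b"
      using a_b w'_simps(2) w'_simps(3)[of j] by (auto simp: larger_after_def)
    from LIS_length_ge_Suc[OF a_b(2) this] j show ?thesis
      using LIS_length_after_b[of j] by (simp add: larger_after_def)
  next
    case False
    then show ?thesis using LIS_length_pos[OF a_b(2), of w'] by simp
  qed
  show "LIS_length n w' b \<le> LIS_length n w b"
  proof (cases "2 \<le> LIS_length n w' b")
    case True
    then obtain j where j: "j \<in> larger_after n w' b" "LIS_length n w' b = Suc (LIS_length n w' j)"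
      using LIS_length_eq_Suc a_b(2) by blast
    then have ja: "j \<in> larger_after n w a" and "b < j" "j \<in> {1..n}"
      using a_b w'_simps(2) w'_simps(3)[of j] by (auto simp: larger_after_def)
    then have "LIS_length n w a \<noteq> Suc (LIS_length n w j)"
      using nested_maximal[OF w ne ab ja] by auto
    with LIS_length_ge_Suc[OF a_b(1) ja] have "Suc (Suc (LIS_length n w j)) \<le> LIS_length n w a"
      by simp
    then show ?thesis
      using nested_LIS_length[OF w ne ab] j LIS_length_after_b[of j] \<open>b < j\<close> \<open>j \<in> {1..n}\<close> by simp
  next
    case False
    then show ?thesis using LIS_length_pos[OF a_b(2), of w] by simp
  qed
qed

text \<open>Between \<open>a\<close> and \<open>b\<close>, only the comparison of \<open>w k\<close>
  with the value at \<open>b\<close> could change. It does not, because \<open>w k\<close> never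
  lies between \<open>w a\<close> and \<open>w b\<close>.\<close>

private lemma LIS_length_after_a:
  assumes "k \<in> {1..n}" "a < k"
  shows "LIS_length n w' k = LIS_length n w k"
  using assms
proof (induction "n - k" arbitrary: k rule: less_induct)
  case less
  consider "b < k" | "k = b" | "k < b" by linarith
  then show ?case
  proof cases
    case 3
    have ka: "k \<noteq> a" "k \<noteq> b" using less.prems 3 by auto
    \<comment> \<open>Otherwise \<open>a\<close>, \<open>k\<close>, \<open>b\<close> could be
      consecutive entries, making the length at \<open>a\<close> exceed the length at
      \<open>b\<close> by at least two.\<close>
    have between: "\<not> (w a < w k \<and> w k < w b)"
    proof
      assume "w a < w k \<and> w k < w b"
      then have "k \<in> larger_after n w a" "b \<in> larger_after n w k"
        using less.prems 3 a_b by (auto simp: larger_after_def)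
      then show False
        using LIS_length_ge_Suc[OF a_b(1)] LIS_length_ge_Suc[OF less.prems(1)]
          nested_LIS_length[OF w ne ab] by fastforce
    qed
    have "w k \<noteq> w a" using permutes_inj[OF w] ka by (metis injD)
    with between have "w a > w k \<longleftrightarrow> w b > w k" using a_b(4) by linarith
    then have "w' k < w' j \<longleftrightarrow> w k < w j" if "k < j" for j
      using that less.prems w'_simps(2) w'_simps(3)[OF ka] w'_simps(3)[of j]
      by (cases "j = b") auto
    then have "larger_after n w' k = larger_after n w k"
      unfolding larger_after_def by blast
    with less.prems(1) show ?thesis
    proof (rule LIS_length_cong)
      fix j assume "j \<in> larger_after n w k"
      then have j: "j \<in> {1..n}" "k < j" by (auto simp: larger_after_def)
      with less.prems have "n - j < n - k" "a < j" by auto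
      with j(1) show "LIS_length n w' j = LIS_length n w j" by (intro less.hyps)
    qed
  next
    case 1
    with less.prems(1) show ?thesis by (rule LIS_length_after_b)
  next
    case 2
    then show ?thesis using LIS_length_at_b by simp
  qed
qed

text \<open>Left of \<open>a\<close> both permutations agree with \<open>longest_perm n\<close>, so
  both lengths are 1.\<close>

lemma LIS_length_step_other:
  assumes "k \<in> {1..n}" "k \<noteq> a"
  shows "LIS_length n (w \<circ> transpose a b) k = LIS_length n w k"
proof (cases "a < k")
  case True
  with assms LIS_length_after_a show ?thesis by (simp add: w'_def)
next
  case False
  with assms have "l \<in> {1..k} \<Longrightarrow> l \<in> {1..<a}" for l by simp
  then have "\<forall>l\<in>{1..k}. w' l = n + 1 - l" "\<forall>l\<in>{1..k}. w l = n + 1 - l"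
    using w'_matched_below nested_matched_below[OF w ne ab] by blast+
  then have "LIS_length n w' k = 1" "LIS_length n w k = 1"
    using LIS_length_matched_prefix assms(1) w w'_permutes by blast+
  then show ?thesis by (simp add: w'_def)
qed

private lemma larger_after_a:
  assumes "j \<in> larger_after n w' a"
  shows "j \<in> larger_after n w a" "j \<noteq> b" "LIS_length n w' j = LIS_length n w j"
proof -
  have j: "j \<in> {1..n}" "a < j" "w b < w' j"
    using assms w'_simps(1) by (auto simp: larger_after_def)
  then show "j \<noteq> b" using a_b(4) w'_simps(2) by auto
  with j have "w' j = w j" using w'_simps(3)[of j] by auto
  with j show "j \<in> larger_after n w a" "LIS_length n w' j = LIS_length n w j"
    using a_b(4) LIS_length_after_a by (simp_all add: larger_after_def)
qed

text \<open>Since \<open>w' a = w b\<close>, position \<open>a\<close> of \<open>w'\<close> inherits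
  the followers that \<open>b\<close> has in \<open>w\<close>.\<close>

private lemma larger_after_b:
  assumes "j \<in> larger_after n w b"
  shows "j \<in> larger_after n w' a" "LIS_length n w' j = LIS_length n w j" "b < j"
proof -
  have j: "j \<in> {1..n}" "b < j" "w b < w j" using assms by (auto simp: larger_after_def)
  then have "a < j" "w' j = w j" using a_b(3) w'_simps(3)[of j] by auto
  with j show "j \<in> larger_after n w' a" "LIS_length n w' j = LIS_length n w j" "b < j"
    using w'_simps(1) LIS_length_after_a by (simp_all add: larger_after_def)
qed

text \<open>The new length at \<open>a\<close> is squeezed between the old lengths at
  \<open>b\<close> and at \<open>a\<close>, which differ by one: followers of \<open>b\<close> in
  \<open>w\<close> follow \<open>a\<close> in \<open>w'\<close>, and followers of \<open>a\<close>
  in \<open>w'\<close> already follow \<open>a\<close> in \<open>w\<close>.\<close>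

private lemma LIS_length_step_first':
  "LIS_length n w' a = LIS_length n w a \<or> Suc (LIS_length n w' a) = LIS_length n w a"
proof -
  have "LIS_length n w' a \<le> LIS_length n w a"
  proof (cases "2 \<le> LIS_length n w' a")
    case True
    with a_b(1) obtain j where j: "j \<in> larger_after n w' a" "LIS_length n w' a = Suc (LIS_length n w' j)"
      by (rule LIS_length_eq_Suc)
    then show ?thesis
      using larger_after_a(3)[OF j(1)] LIS_length_ge_Suc[OF a_b(1) larger_after_a(1)[OF j(1)]] by simp
  qed (use LIS_length_pos[OF a_b(1), of w] in simp)
  moreover have "LIS_length n w b \<le> LIS_length n w' a"
  proof (cases "2 \<le> LIS_length n w b")
    case True
    with a_b(2) obtain j where j: "j \<in> larger_after n w b" "LIS_length n w b = Suc (LIS_length n w j)"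
      by (rule LIS_length_eq_Suc)
    then show ?thesis
      using larger_after_b(2)[OF j(1)] LIS_length_ge_Suc[OF a_b(1) larger_after_b(1)[OF j(1)]] by simp
  qed (use LIS_length_pos[OF a_b(1), of w'] in simp)
  ultimately show ?thesis using nested_LIS_length[OF w ne ab] by linarith
qed

lemmas LIS_length_step_first = LIS_length_step_first'[unfolded w'_def]

text \<open>This covers the last link of the chain, which has no next link to compare with.\<close>

private lemma step_drop_to_one':
  assumes "w' = longest_perm n"
  shows "LIS_length n w' a = 1"
  using a_b(1) by (intro LIS_length_matched_prefix w'_permutes) (auto simp: assms longest_perm_def)

lemmas step_drop_to_one = step_drop_to_one'[unfolded w'_def]

text \<open>If the next link starts after \<open>a\<close>, then \<open>a\<close> is matched and its
  length is 1. Otherwise both links start at \<open>a\<close>, and their second entries are compared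
  by maximality: that of \<open>b\<close> in \<open>w\<close> if the length is unchanged, that of
  \<open>d\<close> in \<open>w'\<close> if it drops.\<close>

private lemma next_link':
  assumes ne': "w' \<noteq> longest_perm n" and cd: "nested n w' = (c, d)"
  shows "LIS_length n w' a = 1 \<and> a < c
    \<or> LIS_length n w' a = LIS_length n w a \<and> c = a \<and> d < b
    \<or> Suc (LIS_length n w' a) = LIS_length n w a \<and> c = a \<and> b < d"
proof -
  have ac: "a \<le> c" using w'_matched_below by (rule nested_fst_ge[OF w'_permutes ne' cd])
  note inc = nested_increasing[OF w'_permutes ne' cd]
  note len = nested_LIS_length[OF w'_permutes ne' cd]
  have d: "d \<in> larger_after n w' c" "1 \<le> LIS_length n w' d"
    using inc LIS_length_pos[of d n w'] by (auto simp: larger_after_def)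
  show ?thesis
  proof (cases "c = a")
    case False
    with ac have "a < c" by simp
    then have "LIS_length n w' a = 1"
      using nested_matched_below[OF w'_permutes ne' cd] a_b(1)
      by (intro LIS_length_matched_prefix w'_permutes) auto
    with \<open>a < c\<close> show ?thesis by simp
  next
    case True
    note d' = larger_after_a[OF d(1)[unfolded True]]
    show ?thesis
    proof (cases "LIS_length n w' a = LIS_length n w a")
      case eq: True
      then have "d \<le> b" using nested_maximal[OF w ne ab d'(1)] d'(3) len True by simp
      with d'(2) eq True show ?thesis by simp
    next
      case False
      then have drop: "Suc (LIS_length n w' a) = LIS_length n w a"
        using LIS_length_step_first' by simp
      then have same: "LIS_length n w b = LIS_length n w' a"
        using nested_LIS_length[OF w ne ab] by simp
      then have "2 \<le> LIS_length n w b" using len d(2) True by simp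
      \<comment> \<open>After a drop, the length at \<open>a\<close> in \<open>w'\<close> equals
        that at \<open>b\<close> in \<open>w\<close>. So a best follower of \<open>b\<close> is a
        candidate for \<open>d\<close>, and it lies to the right of \<open>b\<close>.\<close>
      then obtain j where j: "j \<in> larger_after n w b" "LIS_length n w b = Suc (LIS_length n w j)"
        using LIS_length_eq_Suc[OF a_b(2)] by blast
      note j' = larger_after_b[OF j(1)]
      have "j \<le> d" using j(2) j'(2) same True
        by (intro nested_maximal[OF w'_permutes ne' cd]) (simp_all add: j'(1))
      with j'(3) have "b < d" by simp
      with drop True show ?thesis by simp
    qed
  qed
qed

lemmas next_link = next_link'[unfolded w'_def]
lemmas step_permutes = w'_permutes[unfolded w'_def]

end

subsection \<open>Links of the nested chain\<close>

lemma nested_chain_longest: "nested_chain n (longest_perm n) = []"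
  by (simp add: nested_chain.simps)

lemma nested_chain_step:
  "w permutes {1..n} \<Longrightarrow> w \<noteq> longest_perm n \<Longrightarrow> nested n w = (a, b) \<Longrightarrow>
    nested_chain n w = (a, b) # nested_chain n (w \<circ> transpose a b)"
  by (subst nested_chain.simps) simp

lemma nested_chain_induct [consumes 1, case_names longest step]:
  assumes "w permutes {1..n}"
    and "P (longest_perm n)"
    and "\<And>w a b. w permutes {1..n} \<Longrightarrow> w \<noteq> longest_perm n \<Longrightarrow> nested n w = (a, b) \<Longrightarrow>
      P (w \<circ> transpose a b) \<Longrightarrow> P w"
  shows "P w"
proof -
  \<comment> \<open>In \<open>nested_chain.induct\<close> the number \<open>n\<close> varies too, so
    the premises of the rule are carried inside the induction formula.\<close>
  have "w permutes {1..n} \<longrightarrow> (P (longest_perm n) \<and> (\<forall>w a b. w permutes {1..n} \<longrightarrow>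
    w \<noteq> longest_perm n \<longrightarrow> nested n w = (a, b) \<longrightarrow> P (w \<circ> transpose a b) \<longrightarrow> P w)) \<longrightarrow> P w"
  proof (induction n w rule: nested_chain.induct)
    case (1 n w)
    show ?case
    proof (cases "w = longest_perm n")
      case False
      obtain a b where ab: "nested n w = (a, b)" by fastforce
      show ?thesis
      proof (intro impI, elim conjE)
        assume w: "w permutes {1..n}" and base: "P (longest_perm n)"
          and step: "\<forall>w a b. w permutes {1..n} \<longrightarrow> w \<noteq> longest_perm n \<longrightarrow>
            nested n w = (a, b) \<longrightarrow> P (w \<circ> transpose a b) \<longrightarrow> P w"
        have "P (w \<circ> transpose a b)"
          using 1[OF conjI[OF w False] ab[symmetric]] step_permutes[OF w False ab] base step by blast
        with step w False ab show "P w" by blast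
      qed
    qed simp
  qed
  with assms show ?thesis by blast
qed

lemma nested_chain_fst_pos:
  assumes "w permutes {1..n}" "(i, j) \<in> set (nested_chain n w)"
  shows "1 \<le> i"
  using assms
proof (induction rule: nested_chain_induct)
  case longest
  then show ?case by (simp add: nested_chain_longest)
next
  case (step w a b)
  then show ?case
    using nested_increasing(1)[OF step(1-3)] unfolding nested_chain_step[OF step(1-3)] comp_def
    by auto
qed

text \<open>A link starting at \<open>a\<close> needs \<open>a\<close> unmatched, and swaps to the
  right of \<open>i\<close> leave the prefix up to \<open>i\<close> as it was. Consequently no link
  starts at the end of a fully matched prefix.\<close>

lemma nested_chain_unmatched:
  assumes "w permutes {1..n}" "(i, j) \<in> set (nested_chain n w)"
  shows "\<exists>l\<in>{1..i}. w l \<noteq> n + 1 - l"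
  using assms
proof (induction rule: nested_chain_induct)
  case longest
  then show ?case by (simp add: nested_chain_longest)
next
  case (step w a b)
  note a = nested_increasing[OF step(1-3)] nested_unmatched[OF step(1-3)]
  show ?case
  proof (cases "a \<le> i")
    case True
    with a show ?thesis by auto
  next
    case False
    then have "(i, j) \<in> set (nested_chain n (w \<circ> transpose a b))"
      using step.prems unfolding nested_chain_step[OF step(1-3)] by auto
    then obtain l where l: "l \<in> {1..i}" "(w \<circ> transpose a b) l \<noteq> n + 1 - l"
      using step.IH by blast
    with False a have "(w \<circ> transpose a b) l = w l" by (auto simp: transpose_def)
    with l show ?thesis by auto
  qed
qed

text \<open>Under a matched prefix below \<open>i\<close>, every link applied before
  \<open>(i, j)\<close> also starts at \<open>i\<close>. Each such link raises the value at
  \<open>i\<close>, so an increase found later in the chain was already present in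
  \<open>w\<close>.\<close>

lemma nested_chain_increasing:
  assumes "w permutes {1..n}" "(i, j) \<in> set (nested_chain n w)"
    "\<forall>l\<in>{1..<i}. w l = n + 1 - l"
  shows "w i < w j"
  using assms
proof (induction rule: nested_chain_induct)
  case longest
  then show ?case by (simp add: nested_chain_longest)
next
  case (step w a b)
  note a = nested_increasing[OF step(1-3)] nested_unmatched[OF step(1-3)]
  let ?v = "w \<circ> transpose a b"
  show ?case
  proof (cases "(i, j) = (a, b)")
    case False
    then have in_tail: "(i, j) \<in> set (nested_chain n ?v)"
      using step.prems(1) unfolding nested_chain_step[OF step(1-3)] by auto
    have "i \<le> a" using step.prems(2) a by force
    then have v: "\<forall>l\<in>{1..<i}. ?v l = n + 1 - l"
      using step.prems(2) a by (auto simp: transpose_def)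
    have "i = a"
    proof (rule ccontr)
      assume "i \<noteq> a"
      with \<open>i \<le> a\<close> have "\<forall>l\<in>{1..i}. w l = n + 1 - l"
        using nested_matched_below[OF step(1-3)] by auto
      with nested_chain_unmatched[OF step(1) step.prems(1)] show False by blast
    qed
    with step.IH[OF in_tail v] a show ?thesis
      by (auto simp: transpose_def split: if_splits)
  qed (use a in auto)
qed

text \<open>Once \<open>(a, b)\<close> is applied, the value at \<open>a\<close> exceeds the value
  at \<open>b\<close>, so \<open>nested_chain_increasing\<close> excludes a second occurrence.
  Distinctness lets the cardinality of the set of marked links be computed as a list length.\<close>

lemma distinct_nested_chain:
  assumes "w permutes {1..n}"
  shows "distinct (nested_chain n w)"
  using assms
proof (induction rule: nested_chain_induct)
  case longest
  then show ?case by (simp add: nested_chain_longest)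
next
  case (step w a b)
  let ?v = "w \<circ> transpose a b"
  have "\<forall>l\<in>{1..<a}. ?v l = n + 1 - l"
    using nested_matched_below[OF step(1-3)] nested_increasing(2)[OF step(1-3)]
    by (auto simp: transpose_def)
  then have "(a, b) \<notin> set (nested_chain n ?v)"
    using nested_chain_increasing[OF step_permutes[OF step(1-3)], of a b]
      nested_increasing(4)[OF step(1-3)] by auto
  with step.IH show ?case unfolding nested_chain_step[OF step(1-3)] comp_def by simp
qed

subsection \<open>Counting minimal markings\<close>

text \<open>A recursive list form of the minimal markings; the first argument is the preceding link,
  with \<open>(0, 0)\<close> as the start value modelling \<open>i_0 = 0\<close>.\<close>

fun ascents_from :: "nat \<times> nat \<Rightarrow> (nat \<times> nat) list \<Rightarrow> (nat \<times> nat) list" where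
  "ascents_from (i, j) [] = []"
| "ascents_from (i, j) ((c, d) # C) =
     (if i < c \<or> i = c \<and> j < d then [(c, d)] else []) @ ascents_from (c, d) C"

lemma set_ascents_from_subset: "set (ascents_from p C) \<subseteq> set C"
  by (induction p C rule: ascents_from.induct) auto

lemma distinct_ascents_from: "distinct C \<Longrightarrow> distinct (ascents_from p C)"
proof (induction p C rule: ascents_from.induct)
  case (2 i j c d C)
  with set_ascents_from_subset[of "(c, d)" C] show ?case by auto
qed simp

text \<open>Entry \<open>m\<close> of \<open>p # C\<close> is the predecessor of entry
  \<open>m\<close> of \<open>C\<close>, which matches the indexing of
  \<open>minimal_markings\<close>.\<close>

lemma set_ascents_from:
  "set (ascents_from p C) =
    {C ! m | m. m < length C \<and> (fst ((p # C) ! m) < fst (C ! m) \<or>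
       fst ((p # C) ! m) = fst (C ! m) \<and> snd ((p # C) ! m) < snd (C ! m))}"
    (is "_ = ?S p C")
proof (induction p C rule: ascents_from.induct)
  case (2 i j c d C)
  have "?S (i, j) ((c, d) # C) = (if i < c \<or> i = c \<and> j < d then {(c, d)} else {}) \<union> ?S (c, d) C"
    (is "?A = ?B")
  proof (intro subset_antisym subsetI)
    fix x assume "x \<in> ?A"
    then obtain m where "x = ((c, d) # C) ! m" "m < Suc (length C)"
      "fst (((i, j) # (c, d) # C) ! m) < fst (((c, d) # C) ! m) \<or>
       fst (((i, j) # (c, d) # C) ! m) = fst (((c, d) # C) ! m) \<and>
       snd (((i, j) # (c, d) # C) ! m) < snd (((c, d) # C) ! m)"
      by auto
    then show "x \<in> ?B" by (cases m) auto
  next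
    fix x assume "x \<in> ?B"
    then consider "i < c \<or> i = c \<and> j < d" "x = (c, d)" | "x \<in> ?S (c, d) C"
      by (auto split: if_splits)
    then show "x \<in> ?A"
    proof cases
      case 1
      then show ?thesis by (intro CollectI exI[of _ 0]) auto
    next
      case 2
      then obtain m where "x = C ! m" "m < length C"
        "fst (((c, d) # C) ! m) < fst (C ! m) \<or>
         fst (((c, d) # C) ! m) = fst (C ! m) \<and> snd (((c, d) # C) ! m) < snd (C ! m)"
        by auto
      then show ?thesis by (intro CollectI exI[of _ "Suc m"]) auto
    qed
  qed
  with 2 show ?case by auto
qed simp

text \<open>Positivity of first entries makes the first link marked by \<open>0 < i\<close> alone,
  so the artificial second entry of \<open>(0, 0)\<close> never decides a comparison.\<close>

lemma minimal_markings_eq: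
  assumes "\<And>i j. (i, j) \<in> set C \<Longrightarrow> 1 \<le> i"
  shows "minimal_markings C = set (ascents_from (0, 0) C)"
proof -
  have prev: "((0 # map fst C) ! m < (0 # map fst C) ! Suc m \<or>
      (2 \<le> Suc m \<and> (0 # map fst C) ! m = (0 # map fst C) ! Suc m \<and>
       snd (C ! (m - 1)) < snd (C ! m))) \<longleftrightarrow>
     (fst (((0, 0) # C) ! m) < fst (C ! m) \<or>
      fst (((0, 0) # C) ! m) = fst (C ! m) \<and> snd (((0, 0) # C) ! m) < snd (C ! m))"
    if "m < length C" for m
    using that assms[of "fst (C ! m)" "snd (C ! m)"] by (cases m) auto
  have "minimal_markings C = {C ! m | m. m < length C \<and>
      ((0 # map fst C) ! m < (0 # map fst C) ! Suc m \<or>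
      (2 \<le> Suc m \<and> (0 # map fst C) ! m = (0 # map fst C) ! Suc m \<and>
       snd (C ! (m - 1)) < snd (C ! m)))}"
  proof -
    have "(\<exists>p. x = C ! (p - 1) \<and> p \<in> {1..length C} \<and> Q p) \<longleftrightarrow>
      (\<exists>m. x = C ! m \<and> m < length C \<and> Q (Suc m))" (is "?L \<longleftrightarrow> ?R") for x Q
    proof
      assume ?L
      then obtain p where "x = C ! (p - 1)" "p \<in> {1..length C}" "Q p" by blast
      then show ?R by (intro exI[of _ "p - 1"]) auto
    next
      assume ?R
      then obtain m where "x = C ! m" "m < length C" "Q (Suc m)" by blast
      then show ?L by (intro exI[of _ "Suc m"]) auto
    qed
    then show ?thesis unfolding minimal_markings_def Let_def by simp
  qed
  also have "\<dots> = set (ascents_from (0, 0) C)"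
    unfolding set_ascents_from using prev by (intro Collect_cong) blast
  finally show ?thesis .
qed

text \<open>In the induction hypothesis the tail is read from \<open>(0, 0)\<close>, so its first
  link \<open>(c, d)\<close> counts as marked; in the full chain it is read from
  \<open>(a, b)\<close>. If the length at \<open>a\<close> is unchanged, \<open>(a, b)\<close> gains
  a mark and \<open>(a, d)\<close> loses one. Otherwise \<open>(c, d)\<close> stays marked and
  \<open>(a, b)\<close> adds one at \<open>a\<close>. Counts at other positions do not
  change.\<close>

lemma length_ascents_nested_chain:
  assumes "w permutes {1..n}" "k \<in> {1..n}"
  shows "Suc (length (filter (\<lambda>l. fst l = k) (ascents_from (0, 0) (nested_chain n w)))) = LIS_length n w k"
  using assms
proof (induction rule: nested_chain_induct)
  case longest
  have "longest_perm n permutes {1..n}"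
  proof (rule bij_imp_permutes)
    show "bij_betw (longest_perm n) {1..n} {1..n}"
      by (rule bij_betw_byWitness[where f' = "longest_perm n"]) (auto simp: longest_perm_def)
  qed (auto simp: longest_perm_def)
  then have "LIS_length n (longest_perm n) k = 1"
    using longest by (rule LIS_length_matched_prefix) (use longest in \<open>auto simp: longest_perm_def\<close>)
  then show ?case by (simp add: nested_chain_longest)
next
  case (step w a b)
  let ?v = "w \<circ> transpose a b"
  note inc = nested_increasing[OF step(1-3)]
  note v = step_permutes[OF step(1-3)]
  note first = LIS_length_step_first[OF step(1-3)]
  note other = LIS_length_step_other[OF step(1-3) step.prems]
  have "LIS_length n w b \<ge> 1" using inc by (intro LIS_length_pos) auto
  \<comment> \<open>With this bound, a length of 1 at \<open>a\<close> after the step must come from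
    a drop, from exactly 2.\<close>
  then have two: "LIS_length n w a \<ge> 2" using nested_LIS_length[OF step(1-3)] by simp
  have IH: "Suc (length (filter (\<lambda>l. fst l = k) (ascents_from (0, 0) (nested_chain n ?v)))) = LIS_length n ?v k"
    using step by blast
  show ?case
  proof (cases "?v = longest_perm n")
    case True
    with IH inc other first two step_drop_to_one[OF step(1-3) True] show ?thesis
      by (cases "k = a") (auto simp: nested_chain_step[OF step(1-3)] nested_chain_longest)
  next
    case False
    obtain c d where cd: "nested n ?v = (c, d)" by fastforce
    have "c \<ge> 1" using nested_increasing(1)[OF v False cd] .
    with IH inc other first two next_link[OF step(1-3) False cd] show ?thesis
      by (cases "k = a")
        (auto simp: nested_chain_step[OF step(1-3)] nested_chain_step[OF v False cd] split: if_splits)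
  qed
qed

theorem theorem6p6:
  fixes n :: nat and w :: "nat \<Rightarrow> nat"
  assumes "w permutes {1..n}"
  shows "dual_wt n (xi n w) = dual_rajcode n w"
proof -
  let ?A = "ascents_from (0, 0) (nested_chain n w)"
  have "int (card {l \<in> set ?A. fst l = k}) = int (LIS_length n w k) - 1" if "k \<in> {1..n}" for k
  proof -
    have "card {l \<in> set ?A. fst l = k} = length (filter (\<lambda>l. fst l = k) ?A)"
      using distinct_card[OF distinct_filter[OF distinct_ascents_from[OF distinct_nested_chain[OF assms]]]]
      by (metis set_filter)
    with length_ascents_nested_chain[OF assms that] show ?thesis by simp
  qed
  moreover have "minimal_markings (nested_chain n w) = set ?A"
    using nested_chain_fst_pos[OF assms] by (rule minimal_markings_eq)
  ultimately show ?thesis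
    unfolding dual_wt_def xi_def dual_rajcode_eq prod.case by (intro map_cong refl) auto
qed

end
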